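(* Let $K$ be a direct product of finitely many compact connected simple Lie groups and a compact torus. Let $N,M$ be non-negative integers, $\delta\in\mathbb{C}[x_1,\ldots,x_N]$ a monomial of odd order in each variable, $C_K$ a constant and $f\mapsto\stackrel{\approx}{f}$ a linear map $\mathbb{C}[K]\to\mathbb{C}[x_1,\ldots,x_N,z_1^{\pm1},\ldots,z_M^{\pm1}]$ such that $$\int_K f^a g^b=C_K\int_{(N,M)}\stackrel{\approx}{f}{}^a\,\stackrel{\approx}{g}{}^b\,\delta$$ for all $f,g\in\mathbb{C}[K]$ and all non-negative integers $a,b$. Let $$\mathcal{A}(K)=\{\stackrel{\approx}{f}\ :\ f\in\mathbb{C}[K]\}\subset\mathbb{C}[x_1,\ldots,x_N,z_1^{\pm1},\ldots,z_M^{\pm1}].$$ Then the Mathieu conjecture holds for $K$ if and only if for all $f,g\in\mathcal{A}(K)$ the following is true: if $\int_{(N,M)}f^n\delta=0$ for all $n\in\mathbb{N}$, then $\int_{(N,M)}f^n g\,\delta=0$ for all but finitely many $n\in\mathbb{N}$.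
   Context: $\mathbb{N}=\{1,2,\ldots\}$ and $\mathbb{T}=\{z\in\mathbb{C}:|z|=1\}$. $\mathbb{C}[K]$ is the algebra of $K$-finite functions: the complex linear span of matrix coefficients of finite-dimensional unitary representations of $K$. Integrals over $K$ are with respect to the normalized Haar measure. For $h\in\mathbb{C}[x_1,\ldots,x_N,z_1^{\pm1},\ldots,z_M^{\pm1}]$, $$\int_{(N,M)}h\,\delta:=\int_{[0,1]^N\times\mathbb{T}^M}h(x,z)\,\delta(x)\,dx_1\cdots dx_N\,\frac{dz_1}{z_1}\cdots\frac{dz_M}{z_M},$$ where each $\int_{\mathbb T}\cdots\frac{dz}{z}$ is a contour integral over the positively oriented unit circle. The Mathieu conjecture holds for a compact connected Lie group $K$ if for all $f,g\in\mathbb{C}[K]$: whenever $\int_K f^n=0$ for all $n\in\mathbb{N}$, then $\int_K f^n g=0$ for all but finitely many $n\in\mathbb{N}$. (Data $N,M,\delta,C_K$ and a map $f\mapsto\stackrel{\approx}{f}$ as in the claim exist for every such $K$.) *)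

theory Defs
  imports
    "HOL-Complex_Analysis.Complex_Analysis"
    "HOL-Analysis.Abstract_Euclidean_Space"
    "HOL-Library.Poly_Mapping"
    "HOL-Library.Product_Plus"
    "HOL-Algebra.Product_Groups"
    "Jordan_Normal_Form.Schur_Decomposition"
begin

section \<open>Smooth functions on open subsets of Euclidean space\<close>

definition partial_deriv :: "nat \<Rightarrow> ((nat \<Rightarrow> real) \<Rightarrow> real) \<Rightarrow> (nat \<Rightarrow> real) \<Rightarrow> real" where
  "partial_deriv i f = (\<lambda>x. deriv (\<lambda>t. f (x(i := t))) (x i))"

text \<open>All iterated partial derivatives exist and are continuous on the open set \<open>D\<close>; points
  of \<open>n\<close>-space are the sequences vanishing from index \<open>n\<close> on.\<close>

definition smooth_fun :: "nat \<Rightarrow> (nat \<Rightarrow> real) set \<Rightarrow> ((nat \<Rightarrow> real) \<Rightarrow> real) \<Rightarrow> bool" where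
  "smooth_fun n D f \<longleftrightarrow>
     openin (Euclidean_space n) D \<and>
     (\<forall>js. set js \<subseteq> {..<n} \<longrightarrow>
        (let g = foldr partial_deriv js f in
           continuous_map (subtopology (Euclidean_space n) D) euclideanreal g \<and>
           (\<forall>i<n. \<forall>x\<in>D. (\<lambda>t. g (x(i := t))) differentiable (at (x i)))))"

definition smooth_map ::
    "nat \<Rightarrow> nat \<Rightarrow> (nat \<Rightarrow> real) set \<Rightarrow> ((nat \<Rightarrow> real) \<Rightarrow> nat \<Rightarrow> real) \<Rightarrow> bool" where
  "smooth_map n m D F \<longleftrightarrow> (\<forall>j<m. smooth_fun n D (\<lambda>x. F x j))"


section \<open>Topological groups and Lie groups\<close>

record 'a top_group = "'a monoid" +
  gtop :: "'a topology"

definition topological_group :: "('a, 'b) top_group_scheme \<Rightarrow> bool" where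
  "topological_group G \<longleftrightarrow>
     group G \<and> topspace (gtop G) = carrier G \<and>
     continuous_map (prod_topology (gtop G) (gtop G)) (gtop G) (\<lambda>(x, y). x \<otimes>\<^bsub>G\<^esub> y) \<and>
     continuous_map (gtop G) (gtop G) (\<lambda>x. inv\<^bsub>G\<^esub> x)"

type_synonym 'a chart = "'a set \<times> ('a \<Rightarrow> nat \<Rightarrow> real)"

definition is_chart :: "'a topology \<Rightarrow> nat \<Rightarrow> 'a chart \<Rightarrow> bool" where
  "is_chart X n = (\<lambda>(U, \<phi>).
     openin X U \<and> openin (Euclidean_space n) (\<phi> ` U) \<and>
     homeomorphic_map (subtopology X U) (subtopology (Euclidean_space n) (\<phi> ` U)) \<phi>)"

definition smooth_atlas :: "'a topology \<Rightarrow> nat \<Rightarrow> 'a chart set \<Rightarrow> bool" where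
  "smooth_atlas X n A \<longleftrightarrow>
     (\<forall>c\<in>A. is_chart X n c) \<and> (\<Union>(U, \<phi>)\<in>A. U) = topspace X \<and>
     (\<forall>(U, \<phi>)\<in>A. \<forall>(V, \<psi>)\<in>A. smooth_map n n (\<phi> ` (U \<inter> V)) (\<lambda>w. \<psi> (inv_into U \<phi> w)))"

record 'a lie_group = "'a top_group" +
  lie_dim :: nat
  atlas :: "'a chart set"

text \<open>Smoothness of the multiplication is read off in charts on the domain and codomain, where a
  point \<open>w\<close> of \<open>2n\<close>-space stands for the pair of its first and last \<open>n\<close> coordinates.\<close>

definition fst_half :: "nat \<Rightarrow> (nat \<Rightarrow> real) \<Rightarrow> nat \<Rightarrow> real" where
  "fst_half n w = (\<lambda>i. if i < n then w i else 0)"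

definition snd_half :: "nat \<Rightarrow> (nat \<Rightarrow> real) \<Rightarrow> nat \<Rightarrow> real" where
  "snd_half n w = (\<lambda>i. w (n + i))"

definition smooth_mult :: "('a, 'b) lie_group_scheme \<Rightarrow> bool" where
  "smooth_mult G \<longleftrightarrow>
     (let n = lie_dim G in
      \<forall>(U, \<phi>)\<in>atlas G. \<forall>(V, \<psi>)\<in>atlas G. \<forall>(W, \<rho>)\<in>atlas G.
        let m = (\<lambda>w. inv_into U \<phi> (fst_half n w) \<otimes>\<^bsub>G\<^esub> inv_into V \<psi> (snd_half n w)) in
        smooth_map (n + n) n
          {w \<in> topspace (Euclidean_space (n + n)).
             fst_half n w \<in> \<phi> ` U \<and> snd_half n w \<in> \<psi> ` V \<and> m w \<in> W}
          (\<lambda>w. \<rho> (m w)))"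

definition smooth_inverse :: "('a, 'b) lie_group_scheme \<Rightarrow> bool" where
  "smooth_inverse G \<longleftrightarrow>
     (let n = lie_dim G in
      \<forall>(U, \<phi>)\<in>atlas G. \<forall>(V, \<psi>)\<in>atlas G.
        let m = (\<lambda>w. inv\<^bsub>G\<^esub> (inv_into U \<phi> w)) in
        smooth_map n n {w \<in> \<phi> ` U. m w \<in> V} (\<lambda>w. \<psi> (m w)))"

definition is_lie_group :: "('a, 'b) lie_group_scheme \<Rightarrow> bool" where
  "is_lie_group G \<longleftrightarrow>
     topological_group G \<and> Hausdorff_space (gtop G) \<and> second_countable (gtop G) \<and>
     smooth_atlas (gtop G) (lie_dim G) (atlas G) \<and> smooth_mult G \<and> smooth_inverse G"

text \<open>Simple in the Lie sense: connected, non-abelian, and without nontrivial connected normal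
  subgroups. Finite centre is allowed, as for \<open>SU(2)\<close>.\<close>

definition simple_lie_group :: "('a, 'b) lie_group_scheme \<Rightarrow> bool" where
  "simple_lie_group G \<longleftrightarrow>
     is_lie_group G \<and> connected_space (gtop G) \<and> \<not> comm_group G \<and>
     (\<forall>H. H \<lhd> G \<and> connectedin (gtop G) H \<longrightarrow> H = {\<one>\<^bsub>G\<^esub>} \<or> H = carrier G)"


section \<open>Products of simple groups and a torus\<close>

definition circle_group :: "complex monoid" where
  "circle_group = \<lparr>carrier = sphere 0 1, monoid.mult = (*), one = 1\<rparr>"

definition torus_group :: "nat \<Rightarrow> (nat \<Rightarrow> complex) monoid" where
  "torus_group r = product_group {..<r} (\<lambda>_. circle_group)"

definition torus_topology :: "nat \<Rightarrow> (nat \<Rightarrow> complex) topology" where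
  "torus_topology r = product_topology (\<lambda>_. top_of_set (sphere 0 1)) {..<r}"

text \<open>A direct product is understood up to isomorphism of topological groups. Since each factor
  embeds into \<open>K\<close>, it is no restriction to realise the factors on the type of \<open>K\<close>.\<close>

definition product_of_simple_and_torus :: "('a, 'b) top_group_scheme \<Rightarrow> bool" where
  "product_of_simple_and_torus K \<longleftrightarrow>
     topological_group K \<and>
     (\<exists>(s::nat) (G :: nat \<Rightarrow> 'a lie_group) (r::nat) \<phi>.
        (\<forall>i<s. simple_lie_group (G i) \<and> compact_space (gtop (G i))) \<and>
        \<phi> \<in> iso K (product_group {..<s} G \<times>\<times> torus_group r) \<and>
        homeomorphic_map (gtop K)
          (prod_topology (product_topology (\<lambda>i. gtop (G i)) {..<s}) (torus_topology r)) \<phi>)"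


section \<open>Normalized Haar measure and \<open>K\<close>-finite functions\<close>

text \<open>On a compact Lie group, which is metrizable, every finite Borel measure is regular, and left
  invariance implies right invariance.\<close>

definition normalized_haar_measure :: "('a, 'b) top_group_scheme \<Rightarrow> 'a measure \<Rightarrow> bool" where
  "normalized_haar_measure K \<mu> \<longleftrightarrow>
     space \<mu> = carrier K \<and>
     sets \<mu> = sigma_sets (carrier K) {U. openin (gtop K) U} \<and>
     emeasure \<mu> (carrier K) = 1 \<and>
     (\<forall>g\<in>carrier K. \<forall>A\<in>sets \<mu>. emeasure \<mu> ((\<lambda>x. g \<otimes>\<^bsub>K\<^esub> x) ` A) = emeasure \<mu> A)"

definition unitary_rep :: "('a, 'b) top_group_scheme \<Rightarrow> nat \<Rightarrow> ('a \<Rightarrow> complex mat) \<Rightarrow> bool" where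
  "unitary_rep K n \<pi> \<longleftrightarrow>
     (\<forall>x\<in>carrier K. \<pi> x \<in> carrier_mat n n \<and> mat_adjoint (\<pi> x) * \<pi> x = 1\<^sub>m n) \<and>
     (\<forall>x\<in>carrier K. \<forall>y\<in>carrier K. \<pi> (x \<otimes>\<^bsub>K\<^esub> y) = \<pi> x * \<pi> y) \<and>
     (\<forall>i<n. \<forall>j<n. continuous_map (gtop K) euclidean (\<lambda>x. \<pi> x $$ (i, j)))"

text \<open>Functions on \<open>K\<close> are represented by functions on the ambient type that vanish off the carrier.\<close>

definition matrix_coefficients :: "('a, 'b) top_group_scheme \<Rightarrow> ('a \<Rightarrow> complex) set" where
  "matrix_coefficients K =
     {\<lambda>x. if x \<in> carrier K then (\<pi> x *\<^sub>v u) \<bullet>c v else 0 | n \<pi> u v.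
        unitary_rep K n \<pi> \<and> u \<in> carrier_vec n \<and> v \<in> carrier_vec n}"

definition K_finite :: "('a, 'b) top_group_scheme \<Rightarrow> ('a \<Rightarrow> complex) set" where
  "K_finite K =
     {\<lambda>x. \<Sum>i<m. c i * p i x | (m::nat) c p. \<forall>i<m. p i \<in> matrix_coefficients K}"

definition mathieu_conjecture :: "('a, 'b) top_group_scheme \<Rightarrow> 'a measure \<Rightarrow> bool" where
  "mathieu_conjecture K \<mu> \<longleftrightarrow>
     (\<forall>f\<in>K_finite K. \<forall>g\<in>K_finite K.
        (\<forall>n\<ge>1. (\<integral>x. f x ^ n \<partial>\<mu>) = 0) \<longrightarrow>
        finite {n. n \<ge> 1 \<and> (\<integral>x. f x ^ n * g x \<partial>\<mu>) \<noteq> 0})"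


section \<open>Polynomials, Laurent polynomials and their integrals\<close>

text \<open>Polynomial rings as monoid algebras: a monomial is its finitely supported exponent function,
  and in \<open>laurent\<close> the second component carries the exponents of the invertible variables.
  The \<open>i\<close>-th variable has index \<open>i - 1\<close>.\<close>

type_synonym mpoly = "(nat \<Rightarrow>\<^sub>0 nat) \<Rightarrow>\<^sub>0 complex"
type_synonym laurent = "((nat \<Rightarrow>\<^sub>0 nat) \<times> (nat \<Rightarrow>\<^sub>0 int)) \<Rightarrow>\<^sub>0 complex"

definition laurent_polys :: "nat \<Rightarrow> nat \<Rightarrow> laurent set" where
  "laurent_polys N M =
     {h. \<forall>(d, e)\<in>Poly_Mapping.keys h.
        Poly_Mapping.keys d \<subseteq> {..<N} \<and> Poly_Mapping.keys e \<subseteq> {..<M}}"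

definition odd_monomial :: "nat \<Rightarrow> mpoly \<Rightarrow> bool" where
  "odd_monomial N \<delta> \<longleftrightarrow>
     (\<exists>c d. c \<noteq> 0 \<and> Poly_Mapping.keys d \<subseteq> {..<N} \<and> (\<forall>i<N. odd (Poly_Mapping.lookup d i)) \<and>
        \<delta> = Poly_Mapping.single d c)"

definition mpoly_eval :: "nat \<Rightarrow> mpoly \<Rightarrow> (nat \<Rightarrow> real) \<Rightarrow> complex" where
  "mpoly_eval N p x =
     (\<Sum>d\<in>Poly_Mapping.keys p. Poly_Mapping.lookup p d * (\<Prod>i<N. of_real (x i) ^ Poly_Mapping.lookup d i))"

definition laurent_eval ::
    "nat \<Rightarrow> nat \<Rightarrow> laurent \<Rightarrow> (nat \<Rightarrow> real) \<Rightarrow> (nat \<Rightarrow> complex) \<Rightarrow> complex" where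
  "laurent_eval N M h x z =
     (\<Sum>(d, e)\<in>Poly_Mapping.keys h. Poly_Mapping.lookup h (d, e) *
        (\<Prod>i<N. of_real (x i) ^ Poly_Mapping.lookup d i) * (\<Prod>j<M. z j powi Poly_Mapping.lookup e j))"

text \<open>Iterated contour integrals of \<open>F z\<close> against \<open>dz/z\<close> in each variable; no factor
  \<open>1 / (2 * pi * \<i>)\<close> is included.\<close>

primrec torus_integral :: "nat \<Rightarrow> ((nat \<Rightarrow> complex) \<Rightarrow> complex) \<Rightarrow> complex" where
  "torus_integral 0 F = F (\<lambda>_. 1)"
| "torus_integral (Suc m) F =
     torus_integral m (\<lambda>z. contour_integral (circlepath 0 1) (\<lambda>w. F (z(m := w)) / w))"

definition integral_NM :: "nat \<Rightarrow> nat \<Rightarrow> mpoly \<Rightarrow> laurent \<Rightarrow> complex" where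
  "integral_NM N M \<delta> h =
     (\<integral>x. torus_integral M (\<lambda>z. laurent_eval N M h x z * mpoly_eval N \<delta> x)
        \<partial>(PiM {..<N} (\<lambda>_. restrict_space lborel {0..1})))"

definition linear_to_laurent ::
    "('a, 'b) top_group_scheme \<Rightarrow> nat \<Rightarrow> nat \<Rightarrow> (('a \<Rightarrow> complex) \<Rightarrow> laurent) \<Rightarrow> bool" where
  "linear_to_laurent K N M T \<longleftrightarrow>
     T ` K_finite K \<subseteq> laurent_polys N M \<and>
     (\<forall>f\<in>K_finite K. \<forall>g\<in>K_finite K. T (\<lambda>x. f x + g x) = T f + T g) \<and>
     (\<forall>c. \<forall>f\<in>K_finite K. T (\<lambda>x. c * f x) = Poly_Mapping.single 0 c * T f)"

end

theory Submission
  imports Defs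
begin

text \<open>
  With both exponents zero, the integral formula reads \<open>1 = C * \<integral>\<^bsub>(N,M)\<^esub> \<delta>\<close>, since the Haar
  measure is normalized; hence \<open>C \<noteq> 0\<close>. With second exponent \<open>0\<close> or \<open>1\<close>, it then shows that the
  integral of \<open>f\<^sup>n\<close> or of \<open>f\<^sup>n g\<close> over \<open>K\<close> vanishes exactly when the integral of the corresponding
  Laurent polynomial does. So the two sides of the equivalence are the same assertion, quantified
  once over \<open>K\<close>-finite functions and once over their images under \<open>T\<close>.
\<close>

text \<open>The formula is assumed only for \<open>K\<close>-finite functions, so extracting \<open>C \<noteq> 0\<close> from it takes at
  least one of them.\<close>

lemma zero_in_K_finite: "(\<lambda>_. 0) \<in> K_finite K"
proof -
  have "\<exists>(m::nat) c p. (\<lambda>_. 0) = (\<lambda>x. \<Sum>i<m. c i * p i x :: complex)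
          \<and> (\<forall>i<m. p i \<in> matrix_coefficients K)"
    by (rule exI[of _ 0]) simp
  then show ?thesis
    unfolding K_finite_def by blast
qed

lemma integral_one_normalized_haar_measure:
  assumes "normalized_haar_measure K \<mu>"
  shows "(\<integral>x. (1::complex) \<partial>\<mu>) = 1"
  using assms by (simp add: normalized_haar_measure_def measure_def)

theorem proposition6p2:
  fixes K :: "('k, 'e) top_group_scheme"
    and \<mu> :: "'k measure"
    and N M :: nat
    and \<delta> :: mpoly
    and C :: complex
    and T :: "('k \<Rightarrow> complex) \<Rightarrow> laurent"
    and \<A> :: "laurent set"
  assumes "product_of_simple_and_torus K"
    and "normalized_haar_measure K \<mu>"
    and "odd_monomial N \<delta>"
    and "linear_to_laurent K N M T"
    and "\<And>f g a b. f \<in> K_finite K \<Longrightarrow> g \<in> K_finite K \<Longrightarrow>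
           (\<integral>x. f x ^ a * g x ^ b \<partial>\<mu>) = C * integral_NM N M \<delta> (T f ^ a * T g ^ b)"
  defines "\<A> \<equiv> T ` K_finite K"
  shows "mathieu_conjecture K \<mu> \<longleftrightarrow>
           (\<forall>f\<in>\<A>. \<forall>g\<in>\<A>.
              (\<forall>n\<ge>1. integral_NM N M \<delta> (f ^ n) = 0) \<longrightarrow>
              finite {n. n \<ge> 1 \<and> integral_NM N M \<delta> (f ^ n * g) \<noteq> 0})"
proof -
  note integral_formula = assms(5)
  have "1 = C * integral_NM N M \<delta> 1"
    using integral_formula[OF zero_in_K_finite zero_in_K_finite, of 0 0]
      integral_one_normalized_haar_measure[OF assms(2)] by simp
  then have "C \<noteq> 0"
    by auto
  then have power: "(\<integral>x. f x ^ n \<partial>\<mu>) = 0 \<longleftrightarrow> integral_NM N M \<delta> (T f ^ n) = 0"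
    and power_times: "(\<integral>x. f x ^ n * g x \<partial>\<mu>) = 0 \<longleftrightarrow> integral_NM N M \<delta> (T f ^ n * T g) = 0"
    if "f \<in> K_finite K" "g \<in> K_finite K" for f g n
    using integral_formula[OF that, of n 0] integral_formula[OF that, of n 1] by simp_all
  show ?thesis
    unfolding mathieu_conjecture_def \<A>_def by (simp add: power power_times)
qed

end
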